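(* Let $g(x)=\sum_{s=0}^{\ell}b_sx^s\in\mathbb{R}[x]$ be a polynomial of degree $\ell\ge2$. Let $\Sigma$ be a finite alphabet and let $c\colon[0,1)\to\Sigma$ be a non-constant piecewise-constant function with partition boundaries $0=\gamma_0<\gamma_1<\cdots<\gamma_d=1$. Let $\mathbf{a}=a_0a_1a_2\cdots$ be defined by $a_n=c(\{g(n)\})$ for $n\ge0$. Assume that the leading coefficient $b_\ell$ is badly approximable. Then $\mathbf{Rdio}(\mathbf{a})<\infty$.
   Context: $\{\cdot\}$ denotes the fractional part. That $c$ is piecewise constant with partition boundaries $0=\gamma_0<\cdots<\gamma_d=1$ means that $c$ is constant on each interval $[\gamma_{j-1},\gamma_j)$, $1\le j\le d$. A real number is badly approximable if it is irrational and the partial quotients of its continued fraction expansion are bounded. For integers $0\le r\le s$, $\mathbf{a}[r,s]$ denotes the finite word $a_ra_{r+1}\cdots a_s$. $(\epsilon,\delta)$-closeness: for two finite words $U=u_1\cdots u_L$ and $V=v_1\cdots v_L$ of the same length $L>0$, a real $\epsilon>0$ and an integer $\delta\ge 0$, $U$ and $V$ are $(\epsilon,\delta)$-close if there exist $\delta$ (possibly empty) subintervals $I_1,\dots,I_\delta$ of $\{1,\dots,L\}$ such that $\{1\le i\le L: u_i\ne v_i\}\subseteq \bigcup_{j=1}^{\delta} I_j$ and $\left|\bigcup_{j=1}^{\delta} I_j\right|\le \epsilon L$. Refined Diophantine exponent: for a real $\rho\ge 1$, $\mathbf{a}$ satisfies Condition $( * )_\rho$ if for every $\epsilon>0$ there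 exist three sequences of integers $(r_n)_{n\ge0}$, $(s_n)_{n\ge0}$, $(t_n)_{n\ge0}$ and an integer $\delta\ge0$ such that: $-1\le r_n<s_n<t_n$ for all $n$; $t_n\ge\rho s_n$ for all $n$; $s_n-r_n\to\infty$ as $n\to\infty$; and for all $n$ large enough, $\mathbf{a}[r_n+1,r_n+t_n-s_n]$ and $\mathbf{a}[s_n+1,t_n]$ are $(\epsilon,\delta)$-close. The refined Diophantine exponent $\mathbf{Rdio}(\mathbf{a})\in[1,\infty]$ is the supremum of the $\rho$ for which $\mathbf{a}$ satisfies $( * )_\rho$. *)

theory Defs
  imports "HOL-Analysis.Analysis" "HOL-Computational_Algebra.Polynomial"
begin

text \<open>Regular continued fraction expansion by the Gauss algorithm:
  \<open>\<alpha>\<^sub>0 = \<alpha>\<close>, \<open>\<alpha>\<^sub>n\<^sub>+\<^sub>1 = 1 / {\<alpha>\<^sub>n}\<close>, and the partial quotients are \<open>\<lfloor>\<alpha>\<^sub>n\<rfloor>\<close>.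
  For rational \<open>\<alpha>\<close> the values after termination are meaningless (\<open>1 / 0 = 0\<close>); only irrational
  \<open>\<alpha>\<close> matter below.\<close>

primrec complete_quotient :: "real \<Rightarrow> nat \<Rightarrow> real" where
  "complete_quotient \<alpha> 0 = \<alpha>"
| "complete_quotient \<alpha> (Suc n) = 1 / frac (complete_quotient \<alpha> n)"

definition partial_quotient :: "real \<Rightarrow> nat \<Rightarrow> int" where
  "partial_quotient \<alpha> n = \<lfloor>complete_quotient \<alpha> n\<rfloor>"

definition badly_approximable :: "real \<Rightarrow> bool" where
  "badly_approximable \<alpha> \<longleftrightarrow> \<alpha> \<notin> \<rat> \<and> (\<exists>M. \<forall>n. \<bar>partial_quotient \<alpha> n\<bar> \<le> M)"

text \<open>\<open>\<gamma> 0, \<dots>, \<gamma> d\<close> are the partition boundaries; values of \<open>c\<close> outside \<open>[0, 1)\<close> and of \<open>\<gamma>\<close>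
  beyond \<open>d\<close> are unconstrained.\<close>

definition piecewise_constant :: "(real \<Rightarrow> 'a) \<Rightarrow> (nat \<Rightarrow> real) \<Rightarrow> nat \<Rightarrow> bool" where
  "piecewise_constant c \<gamma> d \<longleftrightarrow>
     \<gamma> 0 = 0 \<and> \<gamma> d = 1 \<and>
     (\<forall>j\<in>{1..d}. \<gamma> (j - 1) < \<gamma> j \<and> c constant_on {\<gamma> (j - 1)..<\<gamma> j})"

text \<open>The word \<open>a\<^sub>r a\<^sub>r\<^sub>+\<^sub>1 \<dots> a\<^sub>s\<close>, for integers \<open>0 \<le> r \<le> s\<close>. The indices are of type \<open>int\<close> because
  the sequences \<open>r\<^sub>n\<close> below may take the value \<open>-1\<close>.\<close>

definition subword :: "(nat \<Rightarrow> 'a) \<Rightarrow> int \<Rightarrow> int \<Rightarrow> 'a list" where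
  "subword a r s = map (\<lambda>i. a (nat i)) [r..s]"

text \<open>Positions in words are numbered from 1, whereas list indices start at 0. An interval
  \<open>{p..q}\<close> with \<open>q < p\<close> is empty.\<close>

definition close_words :: "real \<Rightarrow> nat \<Rightarrow> 'a list \<Rightarrow> 'a list \<Rightarrow> bool" where
  "close_words \<epsilon> \<delta> U V \<longleftrightarrow>
     length U = length V \<and> 0 < length U \<and>
     (\<exists>I :: nat \<Rightarrow> nat set.
        (\<forall>j\<in>{1..\<delta>}. I j \<subseteq> {1..length U} \<and> (\<exists>p q. I j = {p..q})) \<and>
        {i \<in> {1..length U}. U ! (i - 1) \<noteq> V ! (i - 1)} \<subseteq> (\<Union>j\<in>{1..\<delta>}. I j) \<and>
        real (card (\<Union>j\<in>{1..\<delta>}. I j)) \<le> \<epsilon> * real (length U))"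

definition condition_star :: "real \<Rightarrow> (nat \<Rightarrow> 'a) \<Rightarrow> bool" where
  "condition_star \<rho> a \<longleftrightarrow>
     (\<forall>\<epsilon>>0. \<exists>(r :: nat \<Rightarrow> int) (s :: nat \<Rightarrow> int) (t :: nat \<Rightarrow> int) (\<delta> :: nat).
        (\<forall>n. -1 \<le> r n \<and> r n < s n \<and> s n < t n) \<and>
        (\<forall>n. real_of_int (t n) \<ge> \<rho> * real_of_int (s n)) \<and>
        filterlim (\<lambda>n. s n - r n) at_top sequentially \<and>
        (\<forall>\<^sub>F n in sequentially.
           close_words \<epsilon> \<delta> (subword a (r n + 1) (r n + t n - s n)) (subword a (s n + 1) (t n))))"

text \<open>Supremum in the extended reals. Over a finite alphabet the condition always holds for
  \<open>\<rho> = 1\<close> (some letter recurs infinitely often; take words of length 1), so the set is nonempty.\<close>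

definition Rdio :: "(nat \<Rightarrow> 'a) \<Rightarrow> ereal" where
  "Rdio a = Sup {ereal \<rho> | \<rho>. \<rho> \<ge> 1 \<and> condition_star \<rho> a}"

end

theory Submission
  imports Defs
begin

text \<open>For a shift \<open>h \<ge> 1\<close> and a window of length \<open>N \<ge> K h\<close> (\<open>K\<close> large, depending only on \<open>g\<close> and
  \<open>c\<close>), the points \<open>(g(n), g(n + h))\<close> modulo 1 visit any prescribed small box with positive
  frequency. Choosing a box on which the two coordinates carry different letters gives a positive
  proportion of \<open>n\<close> with \<open>a\<^sub>n \<noteq> a\<^sub>n\<^sub>+\<^sub>h\<close>, which rules out \<open>(\<epsilon>, \<delta>)\<close>-closeness for small \<open>\<epsilon>\<close>, whatever
  \<open>\<delta>\<close>. In Condition \<open>(*)\<^sub>\<rho>\<close> one has \<open>h = s - r \<le> 2 s\<close> and \<open>N = t - s \<ge> (\<rho> - 1) s\<close>, so \<open>\<rho>\<close> is at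
  most \<open>2 K + 1\<close>.

  The visits come from Weyl sums over \<open>j g(n) + k g(n + h)\<close>. If \<open>j + k \<noteq> 0\<close> the leading coefficient is
  \<open>(j + k) b\<close>; otherwise it is \<open>k l h b\<close> with \<open>l = deg g\<close>. Differencing with boundedly many shifts
  shows that such a sum is small once all bounded multiples of the leading coefficient
  have distance at least \<open>C / N\<close> from the integers. Bad approximability bounds that distance below by a
  constant multiple of \<open>1 / h\<close>, which suffices as soon as \<open>N \<ge> K h\<close>.\<close>

section \<open>Badly approximable numbers\<close>

lemma complete_quotient_irrational:
  assumes "\<alpha> \<notin> \<rat>"
  shows "complete_quotient \<alpha> n \<notin> \<rat>"
proof (induction n)
  case 0
  then show ?case using assms by simp
next
  case (Suc n)
  let ?x = "complete_quotient \<alpha> n"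
  have eq: "?x = of_int \<lfloor>?x\<rfloor> + 1 / complete_quotient \<alpha> (Suc n)"
    by (simp add: frac_def)
  show ?case
  proof
    assume "complete_quotient \<alpha> (Suc n) \<in> \<rat>"
    then have "of_int \<lfloor>?x\<rfloor> + 1 / complete_quotient \<alpha> (Suc n) \<in> \<rat>"
      by (intro Rats_add Rats_divide) auto
    with eq Suc show False by metis
  qed
qed

text \<open>The denominator \<open>q - 1/2\<close> instead of \<open>q\<close> absorbs the loss in the descent from \<open>(q, x\<^sub>n)\<close> to
  \<open>(p - q \<lfloor>x\<^sub>n\<rfloor>, x\<^sub>n\<^sub>+\<^sub>1)\<close>, so that the constant survives the induction unchanged.\<close>

lemma diophantine_lower_bound_aux:
  fixes x :: "nat \<Rightarrow> real" and m :: real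
  assumes m: "m > 0"
    and step: "\<And>n. frac (x n) = 1 / x (Suc n)"
    and lo: "\<And>n. x (Suc n) \<ge> 1 + 1 / m" and hi: "\<And>n. x (Suc n) \<le> m"
    and "q \<ge> 1"
  shows "\<bar>real q * x n - real_of_int p\<bar> \<ge> (1 / (4 * m\<^sup>2)) / (real q - 1 / 2)"
  using \<open>q \<ge> 1\<close>
proof (induction q arbitrary: n p rule: less_induct)
  case (less q)
  define y where "y = x (Suc n)"
  define p' where "p' = p - int q * \<lfloor>x n\<rfloor>"
  define e where "e = \<bar>real_of_int p' * y - real q\<bar>"
  have e0: "e \<ge> 0" by (simp add: e_def)
  have y: "y \<ge> 1 + 1 / m" "y \<le> m" "y > 1" "m > 1"
    using lo[of n] hi[of n] m by (auto simp: y_def intro: less_le_trans) (smt (verit) divide_pos_pos)+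
  have xn: "x n = of_int \<lfloor>x n\<rfloor> + 1 / y"
    using step[of n] by (simp add: frac_def y_def)
  \<comment> \<open>Multiplying by \<open>y\<close> swaps the roles of the two integers:
    \<open>\<bar>p' * y - q\<bar>\<close> is the same kind of quantity at the next complete
    quotient, with \<open>p'\<close> as the multiplier.\<close>
  have "real q * x n - real_of_int p = (real q - real_of_int p' * y) / y"
    using y by (subst xn) (simp add: p'_def field_simps)
  then have eq: "\<bar>real q * x n - real_of_int p\<bar> = e / y"
    using y by (simp add: e_def abs_minus_commute abs_divide)
  have big: "(1 / (4 * m\<^sup>2)) / (real q - 1 / 2) \<le> 1 / (2 * m\<^sup>2)"
    using \<open>q \<ge> 1\<close> m by (simp add: field_simps)
  have large_e: ?case if "e \<ge> 1 / (2 * m)"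
  proof -
    have "1 / (2 * m\<^sup>2) = (1 / (2 * m)) / m" by (simp add: power2_eq_square)
    also have "\<dots> \<le> e / y" using that y m e0 by (intro frac_le) auto
    finally show ?thesis using eq big by linarith
  qed
  \<comment> \<open>Outside \<open>0 < p' < q\<close> the error \<open>e\<close> is at least
    \<open>1 / (2 * m)\<close> outright; inside, \<open>p'\<close> is a smaller multiplier and the
    induction hypothesis applies at \<open>Suc n\<close>.\<close>
  consider "p' \<le> 0" | "p' \<ge> int q" | "1 \<le> p'" "p' < int q" by linarith
  then show ?case
  proof cases
    case 1
    have "real_of_int p' * y \<le> 0" using 1 y by (simp add: mult_le_0_iff)
    then have "e \<ge> real q" by (simp add: e_def)
    moreover have "1 / (2 * m) \<le> 1" using y by (simp add: field_simps)
    ultimately show ?thesis using large_e \<open>q \<ge> 1\<close> by simp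
  next
    case 2
    have "real_of_int p' * y \<ge> real q * y" using 2 y by (intro mult_right_mono) auto
    then have "e \<ge> real q * (y - 1)" by (simp add: e_def algebra_simps)
    moreover have "real q * (y - 1) \<ge> 1 * (1 / m)"
      using \<open>q \<ge> 1\<close> y m by (intro mult_mono) auto
    moreover have "1 / (2 * m) \<le> 1 / m" using m by (simp add: field_simps)
    ultimately show ?thesis using large_e by simp
  next
    case 3
    define k where "k = nat p'"
    have k: "k \<ge> 1" "k < q" "real_of_int p' = real k" using 3 by (auto simp: k_def)
    show ?thesis
    proof (cases "e \<ge> 1 / (2 * m)")
      case False
      have IH: "e \<ge> (1 / (4 * m\<^sup>2)) / (real k - 1 / 2)"
        using less.IH[OF k(2,1), of "Suc n" "int q"] k(3) by (simp add: e_def y_def)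
      have "real k * y \<le> real q + 1 / (2 * m)" using False k(3) by (simp add: e_def)
      \<comment> \<open>Half of the surplus of \<open>y\<close> over 1 pays for the error
        \<open>1 / (2 * m)\<close>, so \<open>lo\<close> has to give more than
        \<open>y > 1\<close>.\<close>
      moreover have "y / 2 \<ge> 1 / 2 + 1 / (2 * m)" using y(1) by simp
      ultimately have "(real k - 1 / 2) * y \<le> real q - 1 / 2" by (simp add: algebra_simps)
      then have "(1 / (4 * m\<^sup>2)) / (real q - 1 / 2) \<le> (1 / (4 * m\<^sup>2)) / ((real k - 1 / 2) * y)"
        using k y m by (intro divide_left_mono mult_pos_pos) auto
      also have "\<dots> = (1 / (4 * m\<^sup>2)) / (real k - 1 / 2) / y" by simp
      also have "\<dots> \<le> e / y" using IH y by (intro divide_right_mono) auto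
      finally show ?thesis using eq by simp
    qed (rule large_e)
  qed
qed

text \<open>With \<open>m = M + 1\<close> all complete quotients are at most \<open>m\<close>. The
  fractional part of each is the reciprocal of the next, hence at least \<open>1 / m\<close>, so
  from index 1 on they are also at least \<open>1 + 1 / m\<close> and the descent above
  applies.\<close>

lemma badly_approximable_lower_bound:
  assumes "badly_approximable \<alpha>"
  obtains \<kappa> where "\<kappa> > 0"
    "\<And>q p :: int. q \<noteq> 0 \<Longrightarrow> \<bar>real_of_int q * \<alpha> - real_of_int p\<bar> \<ge> \<kappa> / \<bar>real_of_int q\<bar>"
proof -
  obtain M where irr: "\<alpha> \<notin> \<rat>" and M: "\<And>n. \<bar>partial_quotient \<alpha> n\<bar> \<le> M"
    using assms by (auto simp: badly_approximable_def)
  define x where "x = complete_quotient \<alpha>"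
  define m where "m = real_of_int M + 1"
  have M0: "M \<ge> 0" using M[of 0] by linarith
  then have m: "m > 0" by (simp add: m_def)
  have irrx: "x n \<notin> \<rat>" for n using complete_quotient_irrational[OF irr] by (simp add: x_def)
  have frac_pos: "frac (x n) > 0" for n
    using irrx[of n] frac_ge_0[of "x n"] frac_eq_0_iff[of "x n"] Ints_subset_Rats by (metis order_le_less subsetD)
  have step: "frac (x n) = 1 / x (Suc n)" for n by (simp add: x_def)
  have gt1: "x (Suc n) > 1" for n
    using frac_pos[of n] frac_lt_1[of "x n"] by (simp add: x_def)
  have hi: "x n \<le> m" for n
    using M[of n] unfolding partial_quotient_def x_def m_def by linarith
  have lo: "x (Suc n) \<ge> 1 + 1 / m" for n
  proof -
    have "1 / m \<le> 1 / x (Suc (Suc n))"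
      using hi[of "Suc (Suc n)"] gt1[of "Suc n"] by (intro divide_left_mono) auto
    also have "\<dots> = frac (x (Suc n))" using step by simp
    finally have "1 / m \<le> frac (x (Suc n))" .
    moreover have "\<lfloor>x (Suc n)\<rfloor> \<ge> 1" using gt1[of n] by linarith
    ultimately show ?thesis unfolding frac_def by linarith
  qed
  define \<kappa> where "\<kappa> = 1 / (4 * m\<^sup>2)"
  have \<kappa>: "\<kappa> > 0" using m by (simp add: \<kappa>_def)
  have pos: "\<bar>real q * \<alpha> - real_of_int p\<bar> \<ge> \<kappa> / real q" if "q \<ge> 1" for q :: nat and p
  proof -
    have "\<kappa> / real q \<le> \<kappa> / (real q - 1 / 2)"
      using that \<kappa> by (intro divide_left_mono) auto
    also have "\<dots> \<le> \<bar>real q * x 0 - real_of_int p\<bar>"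
      unfolding \<kappa>_def using that by (intro diophantine_lower_bound_aux m step lo hi)
    finally show ?thesis by (simp add: x_def)
  qed
  show ?thesis
  proof (rule that[OF \<kappa>])
    fix q p :: int assume "q \<noteq> 0"
    have "\<bar>real_of_int q * \<alpha> - real_of_int p\<bar> =
        \<bar>real (nat \<bar>q\<bar>) * \<alpha> - real_of_int (sgn q * p)\<bar>"
      using \<open>q \<noteq> 0\<close> by (cases "q > 0") (auto simp: sgn_if)
    also have "\<dots> \<ge> \<kappa> / real (nat \<bar>q\<bar>)" using \<open>q \<noteq> 0\<close> by (intro pos) auto
    finally show "\<bar>real_of_int q * \<alpha> - real_of_int p\<bar> \<ge> \<kappa> / \<bar>real_of_int q\<bar>" by simp
  qed
qed

section \<open>Weyl sums\<close>

text \<open>Averaging the sum over \<open>H\<close> shifts costs at most \<open>2 * H\<close> at the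
  ends of the window. Cauchy-Schwarz and expansion of the squares then leave the diagonal, which
  gives \<open>1 / H\<close>, and the correlations, which give \<open>\<eta>\<close>.\<close>

lemma van_der_Corput_bound:
  fixes u :: "nat \<Rightarrow> complex" and \<eta> :: real
  assumes u: "\<And>n. norm (u n) \<le> 1" and H: "H > 0"
    and corr: "\<And>i j. i < H \<Longrightarrow> j < H \<Longrightarrow> i \<noteq> j \<Longrightarrow>
      norm (\<Sum>n<N. u (n + i) * cnj (u (n + j))) \<le> \<eta> * real N"
    and \<eta>: "\<eta> \<ge> 0"
  shows "norm (\<Sum>n<N. u n) \<le> real N * sqrt (1 / real H + \<eta>) + 2 * real H"
proof -
  define S where "S = (\<Sum>n<N. u n)"
  define V where "V n = (\<Sum>i<H. u (n + i))" for n
  \<comment> \<open>A shift by \<open>i\<close> drops \<open>i\<close> terms at the start of the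
    window and gains \<open>i\<close> at its end.\<close>
  have shift: "norm (S - (\<Sum>n<N. u (n + i))) \<le> 2 * real i" for i
  proof (induction i)
    case (Suc i)
    have "(\<Sum>n<N. u (n + i)) - (\<Sum>n<N. u (n + Suc i)) = u i - u (N + i)"
      using sum_lessThan_telescope'[of "\<lambda>n. u (n + i)" N] by (simp add: sum_subtractf)
    then have "norm ((\<Sum>n<N. u (n + i)) - (\<Sum>n<N. u (n + Suc i))) \<le> 2"
      using norm_triangle_ineq4[of "u i" "u (N + i)"] u[of i] u[of "N + i"] by simp
    moreover have "norm (S - (\<Sum>n<N. u (n + Suc i))) \<le> norm (S - (\<Sum>n<N. u (n + i)))
        + norm ((\<Sum>n<N. u (n + i)) - (\<Sum>n<N. u (n + Suc i)))"
      by (rule order_trans[OF _ norm_triangle_ineq]) simp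
    ultimately show ?case using Suc by simp
  qed (simp add: S_def)
  have "of_nat H * S - (\<Sum>n<N. V n) = (\<Sum>i<H. S - (\<Sum>n<N. u (n + i)))"
    unfolding V_def by (subst sum.swap) (simp add: sum_subtractf)
  also have "norm \<dots> \<le> (\<Sum>i<H. 2 * real H)"
    by (intro sum_norm_le order_trans[OF shift]) auto
  finally have "norm (of_nat H * S - (\<Sum>n<N. V n)) \<le> 2 * (real H)\<^sup>2"
    by (simp add: power2_eq_square)
  moreover have "norm (of_nat H * S) \<le> norm (of_nat H * S - (\<Sum>n<N. V n)) + norm (\<Sum>n<N. V n)"
    by (rule order_trans[OF _ norm_triangle_ineq]) simp
  ultimately have 1: "real H * norm S \<le> norm (\<Sum>n<N. V n) + 2 * (real H)\<^sup>2"
    by (simp add: norm_mult)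
  have "(norm (\<Sum>n<N. V n))\<^sup>2 \<le> (\<Sum>n<N. 1 * norm (V n))\<^sup>2"
    by (intro power_mono) (auto intro: norm_sum)
  also have "\<dots> \<le> (\<Sum>n<N. 1\<^sup>2) * (\<Sum>n<N. (norm (V n))\<^sup>2)"
    by (rule Cauchy_Schwarz_ineq_sum)
  finally have V1: "(norm (\<Sum>n<N. V n))\<^sup>2 \<le> (\<Sum>n<N. 1\<^sup>2) * (\<Sum>n<N. (norm (V n))\<^sup>2)" .
  have V2: "(\<Sum>n<N. (norm (V n))\<^sup>2) \<le> real N * ((real H)\<^sup>2 * (1 / real H + \<eta>))"
  proof -
    have "complex_of_real (\<Sum>n<N. (norm (V n))\<^sup>2) = (\<Sum>n<N. V n * cnj (V n))"
      by (simp add: complex_norm_square del: of_real_power)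
    also have "\<dots> = (\<Sum>n<N. \<Sum>i<H. \<Sum>j<H. u (n + i) * cnj (u (n + j)))"
      by (simp add: V_def sum_product)
    also have "\<dots> = (\<Sum>i<H. \<Sum>j<H. \<Sum>n<N. u (n + i) * cnj (u (n + j)))"
      by (subst sum.swap, rule sum.cong[OF refl], rule sum.swap)
    also have "norm \<dots> \<le> (\<Sum>i<H. \<Sum>j<H. (if i = j then real N else 0) + \<eta> * real N)"
    proof (intro sum_norm_le)
      fix i j assume ij: "i \<in> {..<H}" "j \<in> {..<H}"
      have "norm (\<Sum>n<N. u (n + i) * cnj (u (n + i))) \<le> (\<Sum>n<N. 1)"
        using u by (intro sum_norm_le) (simp add: norm_mult mult_le_one)
      moreover have "0 \<le> \<eta> * real N" using \<eta> by simp
      ultimately show "norm (\<Sum>n<N. u (n + i) * cnj (u (n + j))) \<le>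
          (if i = j then real N else 0) + \<eta> * real N"
        using corr[of i j] ij by (cases "i = j") simp_all
    qed
    also have "\<dots> = real N * ((real H)\<^sup>2 * (1 / real H + \<eta>))"
      using H by (simp add: sum.distrib sum.delta power2_eq_square field_simps)
    also have "norm (complex_of_real (\<Sum>n<N. (norm (V n))\<^sup>2)) = (\<Sum>n<N. (norm (V n))\<^sup>2)"
      by (simp only: norm_of_real) (simp add: sum_nonneg)
    finally show ?thesis .
  qed
  note V1
  also have "(\<Sum>n<N. 1\<^sup>2) * (\<Sum>n<N. (norm (V n))\<^sup>2)
      \<le> (\<Sum>n<N. 1\<^sup>2) * (real N * ((real H)\<^sup>2 * (1 / real H + \<eta>)))"
    by (rule mult_left_mono[OF V2]) simp
  also have "\<dots> = (real N * real H)\<^sup>2 * (1 / real H + \<eta>)" by (simp add: power2_eq_square)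
  finally have "(norm (\<Sum>n<N. V n))\<^sup>2 \<le> (real N * real H)\<^sup>2 * (1 / real H + \<eta>)" .
  then have "norm (\<Sum>n<N. V n) \<le> sqrt ((real N * real H)\<^sup>2 * (1 / real H + \<eta>))"
    by (rule real_le_rsqrt)
  also have "\<dots> = real H * (real N * sqrt (1 / real H + \<eta>))"
    by (simp add: real_sqrt_mult)
  finally have "real H * norm S \<le> real H * (real N * sqrt (1 / real H + \<eta>) + 2 * real H)"
    using 1 by (simp add: power2_eq_square algebra_simps)
  then show ?thesis using H by (simp add: S_def)
qed

section \<open>Top coefficients under a shift of the variable\<close>

lemma degree_le_1E:
  assumes "degree p \<le> Suc 0"
  obtains a b where "p = [:a, b:]"
proof -
  obtain a r where p: "p = pCons a r" by (cases p)
  have "degree r = 0" using assms p by (cases "r = 0") auto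
  then obtain b where "r = [:b:]" by (rule degree_eq_zeroE)
  then show ?thesis using p that by blast
qed

text \<open>Induction through \<open>p = a + x * r\<close>, which the shift turns into
  \<open>a + (x + h) * r(x + h)\<close>. In a difference of two shifts the first coefficient cancels
  and the second leaves a multiple of the old leading coefficient.\<close>

lemma coeff_pcompose_shift:
  fixes p :: "'a :: comm_ring_1 poly"
  assumes "degree p \<le> Suc d"
  shows "coeff (pcompose p [:h, 1:]) (Suc d) = coeff p (Suc d)"
    and "coeff (pcompose p [:h, 1:]) d = coeff p d + of_nat (Suc d) * h * coeff p (Suc d)"
proof -
  have "coeff (pcompose p [:h, 1:]) (Suc d) = coeff p (Suc d) \<and>
    coeff (pcompose p [:h, 1:]) d = coeff p d + of_nat (Suc d) * h * coeff p (Suc d)"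
    using assms
  proof (induction d arbitrary: p)
    case 0
    then obtain a b where "p = [:a, b:]"
      by (rule degree_le_1E)
    then show ?case by (simp add: pcompose_pCons algebra_simps)
  next
    case (Suc d)
    obtain a r where p: "p = pCons a r" by (cases p)
    have r: "degree r \<le> Suc d" using Suc.prems p by (cases "r = 0") auto
    have "degree (pcompose r [:h, 1:]) < Suc (Suc d)"
      using r by (intro le_less_trans[OF degree_pcompose_le]) (auto simp: le_Suc_eq)
    then show ?case using Suc.IH[OF r]
      by (simp add: p pcompose_pCons coeff_eq_0 algebra_simps coeff_pCons split: nat.splits)
  qed
  then show "coeff (pcompose p [:h, 1:]) (Suc d) = coeff p (Suc d)"
    and "coeff (pcompose p [:h, 1:]) d = coeff p d + of_nat (Suc d) * h * coeff p (Suc d)"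
    by auto
qed

section \<open>The character exp(2 pi i x) and exponential sums over polynomials\<close>

definition ep :: "real \<Rightarrow> complex" where "ep x = cis (2 * pi * x)"

lemma ep_add: "ep (x + y) = ep x * ep y"
  by (simp add: ep_def cis_mult distrib_left)

lemma norm_ep [simp]: "norm (ep x) = 1"
  by (simp add: ep_def)

lemma ep_0 [simp]: "ep 0 = 1"
  by (simp add: ep_def)

lemma ep_of_nat_mult: "ep (real n * x) = ep x ^ n"
  by (induction n) (simp_all add: ep_add algebra_simps)

lemma cnj_ep: "cnj (ep x) = ep (- x)"
  by (simp add: ep_def cis_cnj)

lemma ep_of_int [simp]: "ep (of_int k) = 1"
  by (simp add: ep_def)

text \<open>The norm is \<open>2 * sin (pi * y)\<close>, where \<open>y\<close> is the distance of
  \<open>x\<close> to the nearest integer. The sharp constant would be 4; the constant 1 follows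
  from crude bounds on \<open>pi\<close> and the cubic Taylor bound for the sine.\<close>

lemma norm_ep_minus_1:
  assumes "\<And>k :: int. \<delta> \<le> \<bar>x - of_int k\<bar>"
  shows "\<delta> \<le> norm (ep x - 1)"
proof -
  define y where "y = \<bar>x - of_int (round x)\<bar>"
  have y: "0 \<le> y" "y \<le> 1 / 2" "\<delta> \<le> y"
    using of_int_round_abs_le[of x] assms[of "round x"] by (auto simp: y_def abs_minus_commute)
  have "ep x = ep (x - of_int (round x))"
    using ep_add[of "x - of_int (round x)" "of_int (round x)"] by simp
  also have "norm (\<dots> - 1) = 2 * \<bar>sin (pi * (x - of_int (round x)))\<bar>"
    using dist_exp_i_1[of "2 * pi * (x - of_int (round x))"] by (simp add: ep_def cis_conv_exp)
  also have "\<bar>sin (pi * (x - of_int (round x)))\<bar> = \<bar>sin (pi * y)\<bar>"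
  proof (cases "x - of_int (round x) \<ge> 0")
    case False
    then have "pi * (x - of_int (round x)) = - (pi * y)" by (simp add: y_def algebra_simps)
    then show ?thesis by (simp only: sin_minus abs_minus_cancel)
  qed (simp add: y_def)
  finally have eq: "norm (ep x - 1) = 2 * \<bar>sin (pi * y)\<bar>" .
  have "y \<le> 2 * sin (pi * y)"
  proof -
    have "pi * y \<le> 2" using y pi_less_4 mult_mono[of pi 4 y "1/2"] by simp
    define z where "z = pi * y"
    have z: "0 \<le> z" "z \<le> 2" using y \<open>pi * y \<le> 2\<close> by (auto simp: z_def)
    \<comment> \<open>For \<open>z \<le> 2\<close> the cubic term \<open>z^3 / 6\<close> is at most
      \<open>2 * z / 3\<close>, so \<open>sin z \<ge> z / 3 \<ge> y\<close>.\<close>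
    have "z * (4 - z\<^sup>2) \<ge> 0" using z power_mono[of z 2 2] by (intro mult_nonneg_nonneg) auto
    then have "z - z ^ 3 / 6 \<ge> z / 3" by (simp add: field_simps power_numeral_reduce)
    moreover have "\<bar>sin z - z\<bar> \<le> z ^ 3 / 6"
      using Maclaurin_sin_bound[of z 3] z by (simp add: sin_coeff_def numeral_eq_Suc)
    moreover from this have "sin z \<ge> z - z ^ 3 / 6" by linarith
    moreover have "z \<ge> 3 * y" using y pi_gt3 by (simp add: z_def mult_right_mono)
    ultimately show ?thesis using y by (simp add: z_def)
  qed
  then show ?thesis using eq y by linarith
qed

text \<open>All multiples up to \<open>Q\<close> are included because each differencing multiplies
  the leading coefficient by a bounded integer. Quantifying over \<open>p\<close> expresses the
  distance to the nearest integer.\<close>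

definition gapped :: "int \<Rightarrow> real \<Rightarrow> real \<Rightarrow> bool" where
  "gapped Q \<delta> \<theta> \<longleftrightarrow> (\<forall>q p :: int. q \<noteq> 0 \<longrightarrow> \<bar>q\<bar> \<le> Q \<longrightarrow> \<delta> \<le> \<bar>of_int q * \<theta> - of_int p\<bar>)"

lemma gappedD: "gapped Q \<delta> \<theta> \<Longrightarrow> q \<noteq> 0 \<Longrightarrow> \<bar>q\<bar> \<le> Q \<Longrightarrow> \<delta> \<le> \<bar>of_int q * \<theta> - of_int p\<bar>"
  by (simp add: gapped_def)

lemma gapped_of_int_mult:
  assumes "gapped (\<bar>k\<bar> * Q) \<delta> \<theta>" "k \<noteq> 0"
  shows "gapped Q \<delta> (of_int k * \<theta>)"
  unfolding gapped_def
proof (intro allI impI)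
  fix q p :: int assume "q \<noteq> 0" "\<bar>q\<bar> \<le> Q"
  then show "\<delta> \<le> \<bar>of_int q * (of_int k * \<theta>) - of_int p\<bar>"
    using gappedD[OF assms(1), of "k * q" p] assms(2)
    by (simp add: abs_mult mult_left_mono algebra_simps)
qed

lemma gapped_mono: "gapped Q \<delta> \<theta> \<Longrightarrow> Q' \<le> Q \<Longrightarrow> \<delta>' \<le> \<delta> \<Longrightarrow> gapped Q' \<delta>' \<theta>"
  unfolding gapped_def by (meson order_trans)

text \<open>A geometric series whose ratio has distance at least \<open>\<delta>\<close> from
  1.\<close>

lemma weyl_linear:
  assumes gap: "gapped 1 \<delta> \<theta>" and "\<delta> > 0"
  shows "norm (\<Sum>n<N. ep (\<theta> * real n + \<beta>)) \<le> 2 / \<delta>"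
proof -
  have \<delta>: "\<delta> \<le> norm (ep \<theta> - 1)"
    using gappedD[OF gap, of 1] by (intro norm_ep_minus_1) simp
  then have ne: "ep \<theta> \<noteq> 1" using \<open>\<delta> > 0\<close> by auto
  have "(\<Sum>n<N. ep (\<theta> * real n + \<beta>)) = ep \<beta> * (\<Sum>n<N. ep \<theta> ^ n)"
    by (simp add: ep_add sum_distrib_left mult.commute flip: ep_of_nat_mult)
  also have "\<dots> = ep \<beta> * ((ep \<theta> ^ N - 1) / (ep \<theta> - 1))"
    using geometric_sum[OF ne] by simp
  also have "norm \<dots> = norm (ep \<theta> ^ N - 1) / norm (ep \<theta> - 1)"
    by (simp add: norm_mult norm_divide)
  also have "\<dots> \<le> 2 / \<delta>"
    using \<delta> \<open>\<delta> > 0\<close> norm_triangle_ineq4[of "ep \<theta> ^ N" 1]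
    by (intro frac_le) (auto simp: norm_power)
  finally show ?thesis .
qed

text \<open>Induction on the degree by van der Corput differencing. The constants depend on
  \<open>d\<close> and \<open>\<eta>\<close> only, not on \<open>p\<close> or
  \<open>N\<close>.\<close>

lemma weyl_bound:
  assumes "\<eta> > 0"
  obtains Q :: int and C :: real and N\<^sub>0 :: nat where "Q > 0" "C > 0" "N\<^sub>0 > 0"
    "\<And>N p. N \<ge> N\<^sub>0 \<Longrightarrow> degree p \<le> Suc d \<Longrightarrow> gapped Q (C / real N) (coeff p (Suc d)) \<Longrightarrow>
      norm (\<Sum>n<N. ep (poly p (real n))) \<le> \<eta> * real N"
  using assms
proof (induction d arbitrary: \<eta> thesis)
  case 0
  show ?case
  proof (rule 0(1)[of 1 "2 / \<eta>" 1])
    fix N :: nat and p :: "real poly"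
    assume N: "N \<ge> 1" and "degree p \<le> Suc 0" and gap: "gapped 1 (2 / \<eta> / real N) (coeff p (Suc 0))"
    from \<open>degree p \<le> Suc 0\<close> obtain a b where p: "p = [:a, b:]"
      by (rule degree_le_1E)
    have "norm (\<Sum>n<N. ep (b * real n + a)) \<le> 2 / (2 / \<eta> / real N)"
      using gap N 0(2) by (intro weyl_linear) (auto simp: p)
    then show "norm (\<Sum>n<N. ep (poly p (real n))) \<le> \<eta> * real N"
      using 0(2) N by (simp add: p algebra_simps)
  qed (use 0 in auto)
next
  case (Suc d)
  \<comment> \<open>Together with \<open>1 / H < \<eta>'\<close> this makes the square root at most
    \<open>\<eta> / 2\<close>; the choice of \<open>N\<^sub>1\<close> makes the boundary term
    \<open>2 * H\<close> at most \<open>\<eta> / 2 * N\<close>.\<close>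
  define \<eta>' where "\<eta>' = \<eta>\<^sup>2 / 8"
  have \<eta>': "\<eta>' > 0" using Suc.prems(2) by (simp add: \<eta>'_def)
  from Suc.IH[OF _ \<eta>'] obtain Q C N\<^sub>0 where QC: "Q > 0" "C > 0" "N\<^sub>0 > 0"
    and IH: "\<And>N p. N \<ge> N\<^sub>0 \<Longrightarrow> degree p \<le> Suc d \<Longrightarrow> gapped Q (C / real N) (coeff p (Suc d)) \<Longrightarrow>
      norm (\<Sum>n<N. ep (poly p (real n))) \<le> \<eta>' * real N"
    by blast
  obtain H :: nat where H: "H > 0" "1 / real H < \<eta>'"
    using real_arch_inverse[of \<eta>'] \<eta>' by (auto simp: inverse_eq_divide)
  obtain N\<^sub>1 :: nat where N\<^sub>1: "real N\<^sub>1 \<ge> 4 * real H / \<eta>" using real_arch_simple by blast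
  \<comment> \<open>\<open>K\<close> bounds the integer factor that the difference of the shifts by
    \<open>i\<close> and \<open>j\<close> puts in front of the leading coefficient.\<close>
  define K where "K = int (Suc (Suc d)) * int H"
  show ?case
  proof (rule Suc.prems(1)[of "K * Q" C "max N\<^sub>0 N\<^sub>1"])
    fix N and p :: "real poly"
    assume N: "N \<ge> max N\<^sub>0 N\<^sub>1" and deg: "degree p \<le> Suc (Suc d)"
      and gap: "gapped (K * Q) (C / real N) (coeff p (Suc (Suc d)))"
    have corr: "norm (\<Sum>n<N. ep (poly p (real (n + i))) * cnj (ep (poly p (real (n + j))))) \<le> \<eta>' * real N"
      if ij: "i < H" "j < H" "i \<noteq> j" for i j
    proof -
      define D where "D = pcompose p [:real i, 1:] - pcompose p [:real j, 1:]"
      define k where "k = int (Suc (Suc d)) * (int i - int j)"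
      have "degree D \<le> Suc (Suc d)"
        unfolding D_def using deg
        by (intro degree_diff_le order_trans[OF degree_pcompose_le]) auto
      moreover have "coeff D (Suc (Suc d)) = 0"
        using deg by (simp add: D_def coeff_pcompose_shift(1))
      ultimately have "degree D \<le> Suc d"
        by (metis degree_le coeff_eq_0 le_less_Suc_eq linorder_not_less not_less_eq)
      moreover have "coeff D (Suc d) = of_int k * coeff p (Suc (Suc d))"
        using deg by (simp add: D_def k_def coeff_pcompose_shift(2) algebra_simps del: of_nat_Suc)
      moreover have "gapped Q (C / real N) (of_int k * coeff p (Suc (Suc d)))"
      proof (rule gapped_of_int_mult)
        show "k \<noteq> 0" using ij by (simp add: k_def)
        have "\<bar>int i - int j\<bar> \<le> int H" using ij by linarith
        then have "\<bar>k\<bar> \<le> K"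
          unfolding k_def K_def abs_mult by (intro mult_mono) auto
        then show "gapped (\<bar>k\<bar> * Q) (C / real N) (coeff p (Suc (Suc d)))"
          using QC by (intro gapped_mono[OF gap]) (auto intro: mult_right_mono)
      qed
      ultimately have "norm (\<Sum>n<N. ep (poly D (real n))) \<le> \<eta>' * real N"
        using N by (intro IH) auto
      also have "(\<Sum>n<N. ep (poly D (real n))) =
          (\<Sum>n<N. ep (poly p (real (n + i))) * cnj (ep (poly p (real (n + j)))))"
        by (simp add: D_def poly_pcompose cnj_ep add.commute flip: ep_add)
      finally show ?thesis .
    qed
    have "norm (\<Sum>n<N. ep (poly p (real n))) \<le> real N * sqrt (1 / real H + \<eta>') + 2 * real H"
      using H \<eta>' corr by (intro van_der_Corput_bound) auto
    also have "real N * sqrt (1 / real H + \<eta>') \<le> real N * (\<eta> / 2)"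
      using H Suc.prems(2)
      by (intro mult_left_mono real_le_lsqrt) (auto simp: \<eta>'_def power2_eq_square)
    also have "2 * real H \<le> \<eta> / 2 * real N"
    proof -
      have "4 * real H / \<eta> \<le> real N" using N N\<^sub>1 by simp
      then show ?thesis using Suc.prems(2) by (simp add: field_simps)
    qed
    finally show "norm (\<Sum>n<N. ep (poly p (real n))) \<le> \<eta> * real N"
      by (simp add: field_simps)
  qed (use QC H in \<open>auto simp: K_def\<close>)
qed

text \<open>\<open>K\<close> is uniform in \<open>h\<close> and \<open>r\<close>: the leading
  coefficient that matters does not involve \<open>r\<close>, and it involves \<open>h\<close> at
  most as a factor.\<close>

lemma correlation_weyl_bound:
  fixes g :: "real poly" and j k :: int
  assumes deg: "degree g \<ge> 2" and bad: "badly_approximable (lead_coeff g)"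
    and jk: "j \<noteq> 0 \<or> k \<noteq> 0" and "\<eta> > 0"
  obtains K :: nat where
    "\<And>h N r. h \<ge> 1 \<Longrightarrow> N \<ge> K * h \<Longrightarrow>
      norm (\<Sum>n<N. ep (of_int j * poly g (real (r + n)) + of_int k * poly g (real (r + n + h)))) \<le> \<eta> * real N"
proof -
  obtain d where d: "degree g = Suc (Suc d)"
    using deg by (metis add_2_eq_Suc le_Suc_ex)
  define b where "b = lead_coeff g"
  have b: "coeff g (Suc (Suc d)) = b" by (simp add: b_def d)
  obtain \<kappa> where \<kappa>: "\<kappa> > 0"
    "\<And>q p :: int. q \<noteq> 0 \<Longrightarrow> \<bar>real_of_int q * b - real_of_int p\<bar> \<ge> \<kappa> / \<bar>real_of_int q\<bar>"
    using badly_approximable_lower_bound[OF bad] unfolding b_def by blast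
  \<comment> \<open>For \<open>0 < \<bar>q\<bar> \<le> Q\<close>, bad approximability applied to
    \<open>q * m\<close> gives the distance \<open>\<kappa> / \<bar>q * m\<bar>\<close>, which is at
    least \<open>C / N\<close> by the last assumption.\<close>
  have gap: "gapped Q (C / real N) (of_int m * b)"
    if m: "m \<noteq> 0" and "Q > 0" "C > 0" "N > 0" "real N \<ge> C * of_int Q * \<bar>of_int m\<bar> / \<kappa>" for m Q :: int and C N
    unfolding gapped_def
  proof (intro allI impI)
    fix q p :: int assume q: "q \<noteq> 0" "\<bar>q\<bar> \<le> Q"
    have "\<bar>real_of_int (q * m)\<bar> \<le> of_int Q * \<bar>of_int m\<bar>"
      using q by (simp add: abs_mult mult_right_mono)
    then have "C * \<bar>real_of_int (q * m)\<bar> \<le> C * (of_int Q * \<bar>of_int m\<bar>)"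
      using that by (intro mult_left_mono) auto
    also have "\<dots> \<le> real N * \<kappa>" using that \<kappa> by (simp add: field_simps)
    finally have "C / real N \<le> \<kappa> / \<bar>real_of_int (q * m)\<bar>"
      using that q by (simp add: field_simps)
    also have "\<dots> \<le> \<bar>real_of_int (q * m) * b - real_of_int p\<bar>" using q m by (intro \<kappa>) auto
    finally show "C / real N \<le> \<bar>real_of_int q * (real_of_int m * b) - real_of_int p\<bar>"
      by (simp add: mult.assoc)
  qed
  define D where "D r h = smult (of_int j) (pcompose g [:real r, 1:])
    + smult (of_int k) (pcompose g [:real (r + h), 1:])" for r h
  have polyD: "ep (of_int j * poly g (real (r + n)) + of_int k * poly g (real (r + n + h))) = ep (poly (D r h) (real n))"
    for r n h by (simp add: D_def poly_pcompose algebra_simps)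
  have degD: "degree (D r h) \<le> Suc (Suc d)" for r h
    unfolding D_def using d
    by (intro degree_add_le order_trans[OF degree_smult_le] order_trans[OF degree_pcompose_le]) auto
  have top: "coeff (D r h) (Suc (Suc d)) = of_int (j + k) * b" for r h
    using d by (simp add: D_def coeff_pcompose_shift(1) b algebra_simps)
  show ?thesis
  proof (cases "j + k = 0")
    case False
    obtain Q :: int and C :: real and N\<^sub>0 :: nat where W: "Q > 0" "C > 0" "N\<^sub>0 > 0"
      "\<And>N p. N \<ge> N\<^sub>0 \<Longrightarrow> degree p \<le> Suc (Suc d) \<Longrightarrow> gapped Q (C / real N) (coeff p (Suc (Suc d))) \<Longrightarrow>
        norm (\<Sum>n<N. ep (poly p (real n))) \<le> \<eta> * real N"
      using weyl_bound[OF \<open>\<eta> > 0\<close>, of "Suc d"] by blast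
    obtain K\<^sub>1 :: nat where K\<^sub>1: "real K\<^sub>1 \<ge> C * of_int Q * \<bar>of_int (j + k)\<bar> / \<kappa>"
      using real_arch_simple by blast
    show ?thesis
    proof (rule that[of "max N\<^sub>0 K\<^sub>1"])
      fix h N r :: nat assume "h \<ge> 1" "N \<ge> max N\<^sub>0 K\<^sub>1 * h"
      then have N: "N \<ge> max N\<^sub>0 K\<^sub>1" by (metis dual_order.trans mult.commute mult_1 mult_le_mono1)
      then have "real K\<^sub>1 \<le> real N" by simp
      then have "real N \<ge> C * of_int Q * \<bar>of_int (j + k)\<bar> / \<kappa>"
        using K\<^sub>1 by linarith
      then have "gapped Q (C / real N) (coeff (D r h) (Suc (Suc d)))"
        unfolding top using W(1-3) N False by (intro gap) auto
      then show "norm (\<Sum>n<N. ep (of_int j * poly g (real (r + n)) + of_int k * poly g (real (r + n + h)))) \<le> \<eta> * real N"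
        unfolding polyD using N degD by (intro W(4)) auto
    qed
  next
    case True
    then have k: "k \<noteq> 0" "j = - k" using jk by auto
    obtain Q :: int and C :: real and N\<^sub>0 :: nat where W: "Q > 0" "C > 0" "N\<^sub>0 > 0"
      "\<And>N p. N \<ge> N\<^sub>0 \<Longrightarrow> degree p \<le> Suc d \<Longrightarrow> gapped Q (C / real N) (coeff p (Suc d)) \<Longrightarrow>
        norm (\<Sum>n<N. ep (poly p (real n))) \<le> \<eta> * real N"
      using weyl_bound[OF \<open>\<eta> > 0\<close>, of d] by blast
    \<comment> \<open>The top coefficients cancel, and the next one is \<open>m h\<close> times
      \<open>b\<close>. As \<open>m h\<close> is linear in \<open>h\<close>, so is the required
      length \<open>N\<close>.\<close>
    define m where "m h = k * int (Suc (Suc d)) * int h" for h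
    have degD': "degree (D r h) \<le> Suc d" for r h
      using degD[of r h] top[of r h] True
      by (metis degree_le coeff_eq_0 le_less_Suc_eq linorder_not_less not_less_eq mult_zero_left of_int_0)
    have top': "coeff (D r h) (Suc d) = of_int (m h) * b" for r h
      using d by (simp add: D_def coeff_pcompose_shift(2) b k m_def algebra_simps)
    obtain K\<^sub>1 :: nat where K\<^sub>1: "real K\<^sub>1 \<ge> C * of_int Q * \<bar>of_int (m 1)\<bar> / \<kappa>"
      using real_arch_simple by blast
    show ?thesis
    proof (rule that[of "max N\<^sub>0 K\<^sub>1"])
      fix h N r :: nat assume h: "h \<ge> 1" and Nh: "N \<ge> max N\<^sub>0 K\<^sub>1 * h"
      then have N: "N \<ge> max N\<^sub>0 K\<^sub>1" by (metis dual_order.trans mult.commute mult_1 mult_le_mono1)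
      have "C * of_int Q * \<bar>of_int (m h)\<bar> / \<kappa> = C * of_int Q * \<bar>of_int (m 1)\<bar> / \<kappa> * real h"
        by (simp add: m_def abs_mult)
      also have "\<dots> \<le> real K\<^sub>1 * real h" using K\<^sub>1 by (intro mult_right_mono) auto
      also have "\<dots> = real (K\<^sub>1 * h)" by simp
      also have "\<dots> \<le> real N"
        using Nh by (intro of_nat_mono) (metis dual_order.trans max.cobounded2 mult_le_mono1)
      finally have "real N \<ge> C * of_int Q * \<bar>of_int (m h)\<bar> / \<kappa>" .
      moreover have "m h \<noteq> 0" using k h by (simp add: m_def)
      ultimately have "gapped Q (C / real N) (coeff (D r h) (Suc d))"
        unfolding top' using W(1-3) N by (intro gap) auto
      then show "norm (\<Sum>n<N. ep (of_int j * poly g (real (r + n)) + of_int k * poly g (real (r + n + h)))) \<le> \<eta> * real N"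
        unfolding polyD using N degD' by (intro W(4)) auto
    qed
  qed
qed

section \<open>Simultaneous visits to two arcs\<close>

text \<open>The nonnegative trigonometric polynomial \<open>cos\<^sup>2\<^sup>m (\<pi> x)\<close>: away from the integers it is
  exponentially small in \<open>m\<close>, while its mean decays only polynomially.\<close>

definition bump :: "nat \<Rightarrow> real \<Rightarrow> real" where
  "bump m x = ((1 + cos (2 * pi * x)) / 2) ^ m"

text \<open>Fourier coefficient of \<open>bump m\<close> at frequency \<open>i - m\<close>; the
  offset makes the indices run over \<open>0..2 * m\<close>.\<close>

definition bump_coeff :: "nat \<Rightarrow> nat \<Rightarrow> real" where
  "bump_coeff m i = real (2 * m choose i) / 4 ^ m"

lemma one_plus_cos_nonneg: "0 \<le> 1 + cos (x :: real)"
  using cos_ge_minus_one[of x] by linarith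

lemma bump_nonneg: "bump m x \<ge> 0"
  by (simp add: bump_def one_plus_cos_nonneg)

lemma bump_le_1: "bump m x \<le> 1"
  by (simp add: bump_def power_le_one one_plus_cos_nonneg)

text \<open>The base is \<open>(ep x + 1)^2 * ep (- x) / 4\<close>, so the expansion is the binomial
  theorem for the exponent \<open>2 * m\<close>.\<close>

lemma bump_fourier:
  "complex_of_real (bump m x) =
    (\<Sum>i\<le>2 * m. complex_of_real (bump_coeff m i) * ep (of_int (int i - int m) * x))"
proof -
  have inv: "ep x * ep (- x) = 1" by (simp flip: ep_add)
  have cos: "2 * complex_of_real (cos (2 * pi * x)) = ep x + ep (- x)"
    by (simp add: ep_def complex_eq_iff)
  have "(ep x + 1)\<^sup>2 * ep (- x) = ep x * (ep x * ep (- x)) + 2 * (ep x * ep (- x)) + ep (- x)"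
    by (simp add: power2_eq_square algebra_simps)
  also have "\<dots> = 4 * complex_of_real ((1 + cos (2 * pi * x)) / 2)"
  proof -
    have "4 * complex_of_real ((1 + cos (2 * pi * x)) / 2) = 2 + 2 * complex_of_real (cos (2 * pi * x))"
      by (simp add: field_simps)
    then show ?thesis unfolding cos inv by simp
  qed
  finally have four: "(ep x + 1)\<^sup>2 * ep (- x) = 4 * complex_of_real ((1 + cos (2 * pi * x)) / 2)" .
  have "complex_of_real (bump m x) = ((ep x + 1)\<^sup>2 * ep (- x) / 4) ^ m"
    unfolding four bump_def by (subst nonzero_mult_div_cancel_left) simp_all
  also have "\<dots> = (ep x + 1) ^ (2 * m) * ep (- x) ^ m / 4 ^ m"
    by (simp add: power_divide power_mult_distrib power_mult)
  also have "\<dots> = (\<Sum>i\<le>2 * m. of_nat (2 * m choose i) / 4 ^ m * (ep x ^ i * ep (- x) ^ m))"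
    by (simp add: binomial_ring sum_distrib_left sum_distrib_right sum_divide_distrib mult_ac)
  also have "\<dots> = (\<Sum>i\<le>2 * m. complex_of_real (bump_coeff m i) * ep (of_int (int i - int m) * x))"
    by (intro sum.cong refl) (simp add: bump_coeff_def algebra_simps flip: ep_of_nat_mult ep_add)
  finally show ?thesis .
qed

lemma sum_bump_coeff: "(\<Sum>i\<le>2 * m. bump_coeff m i) = 1"
proof -
  have "(\<Sum>i\<le>2 * m. real (2 * m choose i)) = 4 ^ m"
    using choose_row_sum[of "2 * m"] by (simp add: power_mult flip: of_nat_sum)
  then show ?thesis by (simp add: bump_coeff_def flip: sum_divide_distrib)
qed

lemma bump_coeff_nonneg: "bump_coeff m i \<ge> 0"
  by (simp add: bump_coeff_def)

text \<open>Index \<open>m\<close> is frequency 0, so this is the polynomial lower bound for the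
  mean of \<open>bump m\<close>.\<close>

lemma bump_coeff_central:
  assumes "m > 0"
  shows "bump_coeff m m \<ge> 1 / (2 * real m)"
  using central_binomial_lower_bound[OF assms] assms by (simp add: bump_coeff_def field_simps)

lemma bump_small:
  assumes far: "\<And>k :: int. \<delta> \<le> \<bar>x - of_int k\<bar>" and "0 \<le> \<delta>"
  shows "bump m x \<le> ((1 + cos (2 * pi * \<delta>)) / 2) ^ m"
proof -
  define y where "y = \<bar>x - of_int (round x)\<bar>"
  have y: "y \<le> 1 / 2" "\<delta> \<le> y"
    using of_int_round_abs_le[of x] far[of "round x"] by (auto simp: y_def abs_minus_commute)
  have "cos (2 * pi * x) = cos (2 * pi * (x - of_int (round x)))"
    using cos.plus_of_int[of "2 * pi * x" "- round x"] by (simp add: algebra_simps)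
  also have "\<dots> = cos (2 * pi * y)"
    by (cases "x - of_int (round x) \<ge> 0")
      (simp_all add: y_def right_diff_distrib cos_diff)
  also have "\<dots> \<le> cos (2 * pi * \<delta>)"
    using y \<open>0 \<le> \<delta>\<close> by (intro cos_monotone_0_pi_le) auto
  finally show ?thesis
    unfolding bump_def by (intro power_mono) (simp_all add: one_plus_cos_nonneg)
qed

text \<open>In the product of the two Fourier expansions the frequency pair (0, 0) gives the main
  term. Every other pair contributes at most its weight times \<open>\<eta> * N\<close>, and the
  weights sum to 1.\<close>

lemma bump_correlation_lower_bound:
  fixes u v :: "nat \<Rightarrow> real"
  assumes weyl: "\<And>i j :: int. \<bar>i\<bar> \<le> int m \<Longrightarrow> \<bar>j\<bar> \<le> int m \<Longrightarrow> i \<noteq> 0 \<or> j \<noteq> 0 \<Longrightarrow>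
      norm (\<Sum>n<N. ep (of_int i * u n + of_int j * v n)) \<le> \<eta> * real N"
    and "\<eta> \<ge> 0"
  shows "(\<Sum>n<N. bump m (u n - x) * bump m (v n - y)) \<ge> ((bump_coeff m m)\<^sup>2 - \<eta>) * real N"
proof -
  define w where "w = bump_coeff m"
  define S where "S = (\<Sum>n<N. bump m (u n - x) * bump m (v n - y))"
  define E where "E i j = (\<Sum>n<N. ep (of_int (int i - int m) * u n + of_int (int j - int m) * v n))" for i j
  define z where "z i j = ep (- of_int (int i - int m) * x - of_int (int j - int m) * y)" for i j
  \<comment> \<open>The main term, placed at \<open>i = j = m\<close> so that it can be subtracted
    inside the double sum.\<close>
  define M where "M i j = (if i = m then if j = m then complex_of_real ((w m)\<^sup>2 * real N) else 0 else 0)" for i j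
  have ep_split: "ep (of_int (int i - int m) * (u n - x)) * ep (of_int (int j - int m) * (v n - y))
      = z i j * ep (of_int (int i - int m) * u n + of_int (int j - int m) * v n)" for i j n
    by (simp add: z_def algebra_simps flip: ep_add)
  have "complex_of_real S = (\<Sum>n<N. \<Sum>i\<le>2*m. \<Sum>j\<le>2*m.
      of_real (w i * w j) * (z i j * ep (of_int (int i - int m) * u n + of_int (int j - int m) * v n)))"
    unfolding S_def of_real_sum of_real_mult bump_fourier sum_product w_def ep_split[symmetric]
    by (intro sum.cong refl) (simp only: mult_ac)
  also have "\<dots> = (\<Sum>i\<le>2*m. \<Sum>n<N. \<Sum>j\<le>2*m.
      of_real (w i * w j) * (z i j * ep (of_int (int i - int m) * u n + of_int (int j - int m) * v n)))"
    by (rule sum.swap)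
  also have "\<dots> = (\<Sum>i\<le>2*m. \<Sum>j\<le>2*m. of_real (w i * w j) * z i j * E i j)"
    unfolding E_def sum_distrib_left by (rule sum.cong[OF refl], subst sum.swap, simp only: mult.assoc)
  finally have S_eq: "complex_of_real S = (\<Sum>i\<le>2*m. \<Sum>j\<le>2*m. of_real (w i * w j) * z i j * E i j)" .
  have M_eq: "complex_of_real ((w m)\<^sup>2 * real N) = (\<Sum>i\<le>2*m. \<Sum>j\<le>2*m. M i j)"
    by (simp add: M_def sum.If_cases if_distrib[of "\<lambda>f. sum f _"] cong: if_cong)
  have "norm (complex_of_real S - complex_of_real ((w m)\<^sup>2 * real N))
      = norm (\<Sum>i\<le>2*m. \<Sum>j\<le>2*m. of_real (w i * w j) * z i j * E i j - M i j)"
    unfolding S_eq M_eq by (simp only: sum_subtractf)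
  also have "\<dots> \<le> (\<Sum>i\<le>2*m. \<Sum>j\<le>2*m. w i * w j * (\<eta> * real N))"
  proof (intro sum_norm_le)
    fix i j assume ij: "i \<in> {..2*m}" "j \<in> {..2*m}"
    have w: "w i \<ge> 0" "w j \<ge> 0" by (simp_all add: w_def bump_coeff_nonneg)
    show "norm (of_real (w i * w j) * z i j * E i j - M i j) \<le> w i * w j * (\<eta> * real N)"
    proof (cases "i = m \<and> j = m")
      case True
      then show ?thesis using \<open>\<eta> \<ge> 0\<close> by (simp add: M_def z_def E_def power2_eq_square)
    next
      case False
      then have "norm (E i j) \<le> \<eta> * real N"
        unfolding E_def using ij by (intro weyl) auto
      moreover have "M i j = 0" using False by (auto simp: M_def)
      ultimately show ?thesis
        using w by (simp add: norm_mult z_def mult_left_mono)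
    qed
  qed
  also have "\<dots> = (\<Sum>i\<le>2*m. w i) * (\<Sum>j\<le>2*m. w j) * (\<eta> * real N)"
    by (subst sum_product) (simp only: sum_distrib_right)
  also have "\<dots> = \<eta> * real N" by (simp add: w_def sum_bump_coeff)
  finally have "\<bar>S - (w m)\<^sup>2 * real N\<bar> \<le> \<eta> * real N"
    by (simp only: norm_of_real flip: of_real_diff)
  then show ?thesis unfolding S_def[symmetric] w_def[symmetric] by (simp add: algebra_simps)
qed

text \<open>The product of two bumps centred at \<open>x\<close> and \<open>y\<close> is at most the
  indicator of a visit plus \<open>q ^ m\<close>. For large \<open>m\<close> its mean, of order
  \<open>1 / m^2\<close>, dominates \<open>q ^ m\<close>, so visits must account for the
  rest.\<close>

lemma positive_proportion_of_box_visits: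
  fixes g :: "real poly" and x y \<delta> :: real
  assumes deg: "degree g \<ge> 2" and bad: "badly_approximable (lead_coeff g)"
    and \<delta>: "0 < \<delta>" "\<delta> \<le> 1 / 2"
  obtains \<epsilon> :: real and K :: nat where "\<epsilon> > 0"
    "\<And>h N r. h \<ge> 1 \<Longrightarrow> N \<ge> K * h \<Longrightarrow>
      real (card {n. n < N \<and> (\<exists>k :: int. \<bar>poly g (real (r + n)) - x - of_int k\<bar> < \<delta>) \<and>
        (\<exists>k :: int. \<bar>poly g (real (r + n + h)) - y - of_int k\<bar> < \<delta>)}) \<ge> \<epsilon> * real N"
proof -
  define q where "q = (1 + cos (2 * pi * \<delta>)) / 2"
  have "cos (2 * pi * \<delta>) < cos 0"
    using \<delta> by (intro cos_monotone_0_pi) auto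
  then have q: "0 \<le> q" "q < 1"
    by (auto simp: q_def one_plus_cos_nonneg)
  \<comment> \<open>The square root is taken so that squaring the inequality yields
    \<open>m^2 * q ^ m \<le> 1 / 16\<close>.\<close>
  have "(\<lambda>n. real n * sqrt q ^ n) \<longlonglongrightarrow> 0"
    using q by (intro powser_times_n_limit_0) auto
  then have "\<forall>\<^sub>F n in sequentially. real n * sqrt q ^ n < 1 / 4"
    by (rule order_tendstoD) simp
  then obtain m\<^sub>0 where "\<And>n. n \<ge> m\<^sub>0 \<Longrightarrow> real n * sqrt q ^ n < 1 / 4"
    by (auto simp: eventually_at_top_linorder)
  then obtain m where m: "m > 0" "real m * sqrt q ^ m < 1 / 4"
    by (metis zero_less_Suc le_SucI order_refl)
  have "(real m * sqrt q ^ m)\<^sup>2 \<le> (1 / 4)\<^sup>2"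
    using m q by (intro power_mono) auto
  moreover have "(sqrt q ^ m)\<^sup>2 = q ^ m"
    using q by (metis power_mult mult.commute real_sqrt_pow2)
  ultimately have "(real m)\<^sup>2 * q ^ m \<le> (1 / 4)\<^sup>2"
    by (simp only: power_mult_distrib)
  then have "(real m)\<^sup>2 * q ^ m \<le> 1 / 16"
    by (simp add: power_divide)
  then have qm: "q ^ m \<le> 1 / (16 * (real m)\<^sup>2)" using m by (simp add: field_simps)
  define \<eta> where "\<eta> = 1 / (16 * (real m)\<^sup>2)"
  have \<eta>: "\<eta> > 0" using m by (simp add: \<eta>_def)
  define P where "P K i j \<longleftrightarrow> (\<forall>h N r. h \<ge> 1 \<longrightarrow> N \<ge> K * h \<longrightarrow>
      norm (\<Sum>n<N. ep (of_int i * poly g (real (r + n)) + of_int j * poly g (real (r + n + h)))) \<le> \<eta> * real N)"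
    for K :: nat and i j :: int
  have "\<exists>K. i \<noteq> 0 \<or> j \<noteq> 0 \<longrightarrow> P K i j" for i j
  proof (cases "i \<noteq> 0 \<or> j \<noteq> 0")
    case True
    from correlation_weyl_bound[OF deg bad this \<eta>] obtain K where "P K i j"
      unfolding P_def by blast
    then show ?thesis by blast
  qed simp
  then obtain F where F: "\<And>i j. i \<noteq> 0 \<or> j \<noteq> 0 \<Longrightarrow> P (F i j) i j" by metis
  \<comment> \<open>The sum over the finitely many frequency pairs dominates each threshold; the
    arbitrary value \<open>F 0 0\<close> only enlarges it.\<close>
  define K where "K = (\<Sum>i\<in>{-int m..int m}. \<Sum>j\<in>{-int m..int m}. F i j)"
  have FK: "F i j \<le> K" if "\<bar>i\<bar> \<le> int m" "\<bar>j\<bar> \<le> int m" for i j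
  proof -
    have "F i j \<le> (\<Sum>j\<in>{-int m..int m}. F i j)" using that by (intro member_le_sum) auto
    also have "\<dots> \<le> K" unfolding K_def using that by (intro member_le_sum) auto
    finally show ?thesis .
  qed
  show ?thesis
  proof (rule that[of "2 * \<eta>" K])
    fix h N r :: nat assume h: "h \<ge> 1" and N: "N \<ge> K * h"
    define u where "u n = poly g (real (r + n))" for n
    define v where "v n = poly g (real (r + n + h))" for n
    define A where "A = {n. n < N \<and> (\<exists>k :: int. \<bar>u n - x - of_int k\<bar> < \<delta>) \<and> (\<exists>k :: int. \<bar>v n - y - of_int k\<bar> < \<delta>)}"
    have summand: "bump m (u n - x) * bump m (v n - y) \<le> (if n \<in> A then 1 else 0) + q ^ m" if n: "n < N" for n
    proof (cases "n \<in> A")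
      case True
      have "bump m (u n - x) * bump m (v n - y) \<le> 1"
        by (intro mult_le_one bump_le_1 bump_nonneg)
      then show ?thesis using True q by (simp add: add_increasing2)
    next
      case False
      \<comment> \<open>Without a visit one coordinate is far from its centre modulo 1: that factor
        is at most \<open>q ^ m\<close> and the other at most 1.\<close>
      then consider "\<And>k :: int. \<delta> \<le> \<bar>u n - x - of_int k\<bar>" | "\<And>k :: int. \<delta> \<le> \<bar>v n - y - of_int k\<bar>"
        using n unfolding A_def mem_Collect_eq not_less[symmetric] by blast
      then have "bump m (u n - x) \<le> q ^ m \<or> bump m (v n - y) \<le> q ^ m"
        using bump_small[of \<delta>] \<delta> unfolding q_def by (metis less_imp_le)
      then have "bump m (u n - x) * bump m (v n - y) \<le> q ^ m"
        using mult_mono[OF _ bump_le_1, of "bump m (u n - x)" "q ^ m" m "v n - y"]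
          mult_mono[OF bump_le_1, of "bump m (v n - y)" "q ^ m" m "u n - x"] q bump_nonneg by auto
      then show ?thesis using False by simp
    qed
    have "((bump_coeff m m)\<^sup>2 - \<eta>) * real N \<le> (\<Sum>n<N. bump m (u n - x) * bump m (v n - y))"
    proof (rule bump_correlation_lower_bound)
      fix i j :: int assume ij: "\<bar>i\<bar> \<le> int m" "\<bar>j\<bar> \<le> int m" "i \<noteq> 0 \<or> j \<noteq> 0"
      have "F i j * h \<le> N" using FK[OF ij(1,2)] N by (meson mult_le_mono1 order_trans)
      then show "norm (\<Sum>n<N. ep (of_int i * u n + of_int j * v n)) \<le> \<eta> * real N"
        using F[OF ij(3)] h unfolding P_def u_def v_def by blast
    qed (use \<eta> in simp)
    also have "\<dots> \<le> (\<Sum>n<N. (if n \<in> A then 1 else 0) + q ^ m)"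
      using summand by (intro sum_mono) simp
    also have "\<dots> = real (card A) + real N * q ^ m"
    proof -
      have "{..<N} \<inter> A = A" by (auto simp: A_def)
      then show ?thesis by (simp add: sum.distrib sum.If_cases)
    qed
    also have "\<dots> \<le> real (card A) + real N * \<eta>"
      using qm mult_left_mono[of "q ^ m" \<eta> "real N"] by (simp add: \<eta>_def)
    finally have "((bump_coeff m m)\<^sup>2 - 2 * \<eta>) * real N \<le> real (card A)" by (simp add: algebra_simps)
    \<comment> \<open>The main term is at least \<open>4 * \<eta>\<close>; the Weyl error and the
      tail \<open>q ^ m\<close> cost \<open>\<eta>\<close> each, which leaves
      \<open>2 * \<eta>\<close>.\<close>
    moreover have "(bump_coeff m m)\<^sup>2 \<ge> 4 * \<eta>"
      using power_mono[OF bump_coeff_central[OF m(1)], of 2] by (simp add: \<eta>_def power2_eq_square)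
    then have "2 * \<eta> * real N \<le> ((bump_coeff m m)\<^sup>2 - 2 * \<eta>) * real N"
      by (intro mult_right_mono) auto
    ultimately show "real (card {n. n < N \<and> (\<exists>k :: int. \<bar>poly g (real (r + n)) - x - of_int k\<bar> < \<delta>) \<and>
        (\<exists>k :: int. \<bar>poly g (real (r + n + h)) - y - of_int k\<bar> < \<delta>)}) \<ge> 2 * \<eta> * real N"
      unfolding A_def u_def v_def by linarith
  qed (use \<eta> in simp)
qed

section \<open>Closeness of factors\<close>

lemma subword_eq_map_upt:
  assumes "0 \<le> p"
  shows "subword a p (p + int N - 1) = map (\<lambda>i. a (nat p + i)) [0..<N]"
proof (rule nth_equalityI)
  fix i assume "i < length (subword a p (p + int N - 1))"
  then show "subword a p (p + int N - 1) ! i = map (\<lambda>i. a (nat p + i)) [0..<N] ! i"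
    using assms by (simp add: subword_def nat_add_distrib)
qed (simp add: subword_def)

lemma close_words_mismatches:
  assumes "close_words \<epsilon> \<delta> U V"
  shows "real (card {i. i < length U \<and> U ! i \<noteq> V ! i}) \<le> \<epsilon> * real (length U)"
proof -
  from assms obtain I :: "nat \<Rightarrow> nat set" where I:
    "\<forall>j\<in>{1..\<delta>}. I j \<subseteq> {1..length U} \<and> (\<exists>p q. I j = {p..q})"
    "{i \<in> {1..length U}. U ! (i - 1) \<noteq> V ! (i - 1)} \<subseteq> (\<Union>j\<in>{1..\<delta>}. I j)"
    "real (card (\<Union>j\<in>{1..\<delta>}. I j)) \<le> \<epsilon> * real (length U)"
    unfolding close_words_def by (elim conjE exE)
  \<comment> \<open>\<open>Suc\<close> passes from list indices to positions counted from 1.\<close>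
  have "Suc ` {i. i < length U \<and> U ! i \<noteq> V ! i} \<subseteq> (\<Union>j\<in>{1..\<delta>}. I j)"
    by (rule order_trans[OF _ I(2)]) auto
  moreover have "(\<Union>j\<in>{1..\<delta>}. I j) \<subseteq> {1..length U}"
    using I(1) by blast
  then have "finite (\<Union>j\<in>{1..\<delta>}. I j)"
    by (rule finite_subset) simp
  ultimately have "card (Suc ` {i. i < length U \<and> U ! i \<noteq> V ! i}) \<le> card (\<Union>j\<in>{1..\<delta>}. I j)"
    by (intro card_mono)
  then show ?thesis using I(3) by (simp add: card_image)
qed

text \<open>Closeness with \<open>\<epsilon> / 2\<close> contradicts a mismatch proportion of at
  least \<open>\<epsilon>\<close> as soon as \<open>t - s \<ge> K * (s - r)\<close>, which a larger
  \<open>\<rho>\<close> would force.\<close>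

lemma condition_star_bound:
  fixes a :: "nat \<Rightarrow> 'a" and K :: nat
  assumes \<epsilon>: "\<epsilon> > 0"
    and mism: "\<And>h N r. h \<ge> 1 \<Longrightarrow> N \<ge> K * h \<Longrightarrow>
      real (card {n. n < N \<and> a (r + n) \<noteq> a (r + n + h)}) \<ge> \<epsilon> * real N"
    and star: "condition_star \<rho> a"
  shows "\<rho> \<le> 2 * real K + 1"
proof (rule ccontr)
  assume "\<not> ?thesis"
  then have \<rho>: "\<rho> - 1 \<ge> 2 * real K" by simp
  have "\<epsilon> / 2 > 0" using \<epsilon> by simp
  with star obtain r s t :: "nat \<Rightarrow> int" and \<delta> :: nat where
    rst: "\<And>n. -1 \<le> r n \<and> r n < s n \<and> s n < t n"
    and t: "\<And>n. real_of_int (t n) \<ge> \<rho> * real_of_int (s n)"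
    and lim: "filterlim (\<lambda>n. s n - r n) at_top sequentially"
    and cl: "\<forall>\<^sub>F n in sequentially.
        close_words (\<epsilon> / 2) \<delta> (subword a (r n + 1) (r n + t n - s n)) (subword a (s n + 1) (t n))"
    unfolding condition_star_def by blast
  \<comment> \<open>With \<open>r n \<ge> -1\<close> this gives \<open>s n \<ge> 1\<close>, hence
    \<open>s n - r n \<le> s n + 1 \<le> 2 * s n\<close>.\<close>
  have "\<forall>\<^sub>F n in sequentially. s n - r n \<ge> 2"
    using lim by (simp add: filterlim_at_top)
  from eventually_happens'[OF _ eventually_conj[OF this cl]] obtain n where
    big: "s n - r n \<ge> 2" and close: "close_words (\<epsilon> / 2) \<delta>
      (subword a (r n + 1) (r n + t n - s n)) (subword a (s n + 1) (t n))"
    by auto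
  define N where "N = nat (t n - s n)"
  define h where "h = nat (s n - r n)"
  define p where "p = nat (r n + 1)"
  have N: "N > 0" "int N = t n - s n" and h: "h \<ge> 1" "int h = s n - r n" and p: "int p = r n + 1"
    using rst[of n] by (auto simp: N_def h_def p_def)
  have U: "subword a (r n + 1) (r n + t n - s n) = map (\<lambda>i. a (p + i)) [0..<N]"
  proof -
    have "r n + t n - s n = r n + 1 + int N - 1" using N by simp
    then show ?thesis
      using subword_eq_map_upt[of "r n + 1" a N] rst[of n] by (simp only: p_def) simp
  qed
  have V: "subword a (s n + 1) (t n) = map (\<lambda>i. a (p + i + h)) [0..<N]"
  proof -
    have "nat (s n + 1) = p + h" using h p by linarith
    moreover have "t n = s n + 1 + int N - 1" using N by simp
    moreover have "0 \<le> s n + 1" using rst[of n] by linarith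
    ultimately show ?thesis
      using subword_eq_map_upt[of "s n + 1" a N] by (simp only: add.assoc add.commute[of h])
  qed
  have "real h \<le> 2 * real_of_int (s n)" using rst[of n] big h by linarith
  then have "real K * real h \<le> real K * (2 * real_of_int (s n))" by (rule mult_left_mono) simp
  also have "\<dots> = 2 * real K * real_of_int (s n)" by simp
  also have "\<dots> \<le> (\<rho> - 1) * real_of_int (s n)"
    using \<rho> rst[of n] by (intro mult_right_mono) auto
  also have "\<dots> = \<rho> * real_of_int (s n) - real_of_int (s n)" by (simp add: left_diff_distrib)
  also have "\<dots> \<le> real N"
  proof -
    have "real N = real_of_int (t n) - real_of_int (s n)"
      using N(2) by (metis of_int_diff of_int_of_nat_eq)
    then show ?thesis using t[of n] by simp
  qed
  finally have "N \<ge> K * h" by (simp only: of_nat_le_iff flip: of_nat_mult)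
  from mism[OF h(1) this, of p] have "\<epsilon> * real N \<le> real (card {i. i < N \<and> a (p + i) \<noteq> a (p + i + h)})" .
  also have "{i. i < N \<and> a (p + i) \<noteq> a (p + i + h)} =
      {i. i < N \<and> map (\<lambda>i. a (p + i)) [0..<N] ! i \<noteq> map (\<lambda>i. a (p + i + h)) [0..<N] ! i}"
    by auto
  also have "real (card \<dots>) \<le> \<epsilon> / 2 * real N"
    using close_words_mismatches[OF close[unfolded U V]] by simp
  finally show False using \<epsilon> N by simp
qed

text \<open>Two points with different values lie in partition intervals that carry different values;
  \<open>x\<close> and \<open>y\<close> are the midpoints of these intervals.\<close>

lemma piecewise_constant_two_arcs:
  assumes pc: "piecewise_constant c \<gamma> d" and nc: "\<not> c constant_on {0..<1}"
  obtains x y \<delta> :: real where "0 < \<delta>" "\<delta> \<le> 1 / 2"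
    "\<And>u v. \<bar>u - x\<bar> < \<delta> \<Longrightarrow> \<bar>v - y\<bar> < \<delta> \<Longrightarrow> u \<in> {0..<1} \<and> v \<in> {0..<1} \<and> c u \<noteq> c v"
proof -
  have \<gamma>: "\<gamma> 0 = 0" "\<gamma> d = 1" and less: "\<And>j. j < d \<Longrightarrow> \<gamma> j < \<gamma> (Suc j)"
    and const: "\<And>j. j < d \<Longrightarrow> c constant_on {\<gamma> j..<\<gamma> (Suc j)}"
    using pc unfolding piecewise_constant_def by force+
  have mono: "\<gamma> i \<le> \<gamma> j" if "i \<le> j" "j \<le> d" for i j
    using that
  proof (induction j rule: dec_induct)
    case (step n)
    then show ?case using less[of n] by simp
  qed simp
  have cover: "\<exists>j<d. z \<in> {\<gamma> j..<\<gamma> (Suc j)}" if z: "z \<in> {0..<1}" for z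
  proof -
    \<comment> \<open>The first boundary beyond \<open>z\<close> is the right end of its interval;
      it is not \<open>\<gamma> 0 = 0\<close> because \<open>z \<ge> 0\<close>.\<close>
    define k where "k = (LEAST k. z < \<gamma> k)"
    have ex: "z < \<gamma> d" using z \<gamma> by simp
    have k: "z < \<gamma> k" "k \<le> d" unfolding k_def using ex by (auto intro: LeastI Least_le)
    then have "k \<noteq> 0" using z \<gamma> by (metis atLeastLessThan_iff not_less)
    then obtain j where j: "k = Suc j" by (metis not0_implies_Suc)
    have "\<not> z < \<gamma> j" using not_less_Least[of j "\<lambda>k. z < \<gamma> k"] j k_def by simp
    then show ?thesis using k j by (intro exI[of _ j]) auto
  qed
  obtain z w where zw: "z \<in> {0..<1}" "w \<in> {0..<1}" "c z \<noteq> c w"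
    using nc unfolding constant_on_def by metis
  from cover[OF zw(1)] obtain i where i: "i < d" "z \<in> {\<gamma> i..<\<gamma> (Suc i)}" by blast
  from cover[OF zw(2)] obtain j where j: "j < d" "w \<in> {\<gamma> j..<\<gamma> (Suc j)}" by blast
  \<comment> \<open>Half of the shorter length, so that both arcs stay inside their
    intervals.\<close>
  define \<delta> where "\<delta> = min (\<gamma> (Suc i) - \<gamma> i) (\<gamma> (Suc j) - \<gamma> j) / 2"
  have arc: "u \<in> {\<gamma> k..<\<gamma> (Suc k)} \<and> u \<in> {0..<1}"
    if "\<bar>u - (\<gamma> k + \<gamma> (Suc k)) / 2\<bar> < \<delta>" "\<delta> \<le> (\<gamma> (Suc k) - \<gamma> k) / 2" "k < d" for u k
  proof -
    have "\<gamma> k \<le> u" "u < \<gamma> (Suc k)" using that(1,2) by (auto simp: abs_less_iff field_simps)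
    then show ?thesis using mono[of 0 k] mono[of "Suc k" d] \<gamma> that(3) by auto
  qed
  show ?thesis
  proof (rule that[of \<delta> "(\<gamma> i + \<gamma> (Suc i)) / 2" "(\<gamma> j + \<gamma> (Suc j)) / 2"])
    show "0 < \<delta>" using less i j by (simp add: \<delta>_def)
    have "\<gamma> (Suc i) - \<gamma> i \<le> 1" using mono[of 0 i] mono[of "Suc i" d] \<gamma> i by simp
    then show "\<delta> \<le> 1 / 2" by (simp add: \<delta>_def)
    fix u v assume uv: "\<bar>u - (\<gamma> i + \<gamma> (Suc i)) / 2\<bar> < \<delta>" "\<bar>v - (\<gamma> j + \<gamma> (Suc j)) / 2\<bar> < \<delta>"
    have u: "u \<in> {\<gamma> i..<\<gamma> (Suc i)} \<and> u \<in> {0..<1}" using arc[OF uv(1)] i by (simp add: \<delta>_def)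
    have v: "v \<in> {\<gamma> j..<\<gamma> (Suc j)} \<and> v \<in> {0..<1}" using arc[OF uv(2)] j by (simp add: \<delta>_def)
    have "c u = c z" using const[OF i(1)] u i(2) unfolding constant_on_def by metis
    moreover have "c v = c w" using const[OF j(1)] v j(2) unfolding constant_on_def by metis
    ultimately show "u \<in> {0..<1} \<and> v \<in> {0..<1} \<and> c u \<noteq> c v" using u v zw by simp
  qed
qed

lemma frac_eq_diff_of_int:
  fixes x :: real
  assumes "x - of_int k \<in> {0..<1}"
  shows "frac x = x - of_int k"
  using assms by (metis atLeastLessThan_iff frac_unique_iff Ints_of_int diff_diff_eq2 add_diff_cancel_left')

theorem theorem8p4:
  fixes g :: "real poly" and \<Sigma> :: "'a set" and c :: "real \<Rightarrow> 'a"
    and \<gamma> :: "nat \<Rightarrow> real" and d :: nat and a :: "nat \<Rightarrow> 'a"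
  assumes "degree g \<ge> 2"
    and "finite \<Sigma>"
    and "c \<in> {0..<1} \<rightarrow> \<Sigma>"
    and "piecewise_constant c \<gamma> d"
    and "\<not> c constant_on {0..<1}"
    and "\<And>n. a n = c (frac (poly g (real n)))"
    and "badly_approximable (lead_coeff g)"
  shows "Rdio a < \<infinity>"
proof -
  obtain x y \<delta> :: real where \<delta>: "0 < \<delta>" "\<delta> \<le> 1 / 2"
    and arcs: "\<And>u v. \<bar>u - x\<bar> < \<delta> \<Longrightarrow> \<bar>v - y\<bar> < \<delta> \<Longrightarrow> u \<in> {0..<1} \<and> v \<in> {0..<1} \<and> c u \<noteq> c v"
    using piecewise_constant_two_arcs[OF assms(4,5)] by metis
  obtain \<epsilon> and K :: nat where \<epsilon>: "\<epsilon> > 0"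
    and visits: "\<And>h N r. h \<ge> 1 \<Longrightarrow> N \<ge> K * h \<Longrightarrow>
      real (card {n. n < N \<and> (\<exists>k :: int. \<bar>poly g (real (r + n)) - x - of_int k\<bar> < \<delta>) \<and>
        (\<exists>k :: int. \<bar>poly g (real (r + n + h)) - y - of_int k\<bar> < \<delta>)}) \<ge> \<epsilon> * real N"
    using positive_proportion_of_box_visits[OF assms(1,7) \<delta>] by blast
  have differ: "a m \<noteq> a n"
    if k: "\<bar>poly g (real m) - x - of_int k\<bar> < \<delta>" and l: "\<bar>poly g (real n) - y - of_int l\<bar> < \<delta>" for m n k l
  proof -
    \<comment> \<open>The arcs lie inside \<open>[0, 1)\<close>, so these integer translates are the
      fractional parts themselves.\<close>
    define u where "u = poly g (real m) - of_int k"
    define v where "v = poly g (real n) - of_int l"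
    have uv: "u \<in> {0..<1} \<and> v \<in> {0..<1} \<and> c u \<noteq> c v"
      using k l by (intro arcs) (simp_all add: u_def v_def algebra_simps)
    then have "frac (poly g (real m)) = u" "frac (poly g (real n)) = v"
      unfolding u_def v_def by (auto intro!: frac_eq_diff_of_int)
    then show ?thesis using uv assms(6) by simp
  qed
  have "\<rho> \<le> 2 * real K + 1" if "condition_star \<rho> a" for \<rho>
  proof (rule condition_star_bound[OF \<epsilon> _ that])
    fix h N r :: nat assume "h \<ge> 1" "N \<ge> K * h"
    note visits[OF this, of r]
    also have "card {n. n < N \<and> (\<exists>k :: int. \<bar>poly g (real (r + n)) - x - of_int k\<bar> < \<delta>) \<and>
        (\<exists>k :: int. \<bar>poly g (real (r + n + h)) - y - of_int k\<bar> < \<delta>)}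
      \<le> card {n. n < N \<and> a (r + n) \<noteq> a (r + n + h)}"
      using differ by (intro card_mono) auto
    finally show "\<epsilon> * real N \<le> real (card {n. n < N \<and> a (r + n) \<noteq> a (r + n + h)})" by simp
  qed
  then have "Rdio a \<le> ereal (2 * real K + 1)"
    unfolding Rdio_def by (intro Sup_least) auto
  then show ?thesis by (auto simp: less_ereal.simps intro: le_less_trans)
qed

end
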